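(* Let $P$ be an isonemal prefabric of order greater than $4$ whose symmetry group is of type $p4/-$, $p4/p4$ or $p4/p2$. Then the symmetry group of $P$ must have a lattice unit (of $G_1$) that either has its centre at a cell centre and is of level $1$ or $2$, or has its centre at a cell corner and is of level $1$, $2$, $3$ or $4$.
   Context: The plane $E$ is tessellated by unit squares called cells, with horizontal and vertical sides. The strands are the vertical columns of cells (warps) and the horizontal rows of cells (wefts). A prefabric assigns to each cell which of the two strands crossing there is uppermost. A symmetry is a pair $(g,\epsilon)$, where $g$ is an isometry of $E$ mapping the tessellation by cells to itself and $\epsilon\in\{e,\tau\}$: if $\epsilon=e$, $g$ carries the uppermost strand at each cell $c$ to the uppermost strand at $g(c)$; if $\epsilon=\tau$ (reversal of the two sides of $E$), $g$ carries the uppermost strand at $c$ to the lowermost strand at $g(c)$. The symmetries form the group $G$; $G_1$ is the planar group of all $g$ occurring in elements of $G$, and $H_1=\{g:(g,e)\in G\}$ is its side-preserving subgroup. The prefabric is isonemal if $G$ is transitive on the strands. Its order is the least positive integer $n$ such that the over-under sequence along the strands repeats every $n$ cells. The type of the symmetry group is written $G_1/H_1$ with the crystallographic types of these groups substituted: $p4/-$ means $G_1$ is of type $p4$ and $H_1=G_1$; $p4/p4$ means both are of type $p4$ and $H_1\neq G_1$; $p4/p2$ means $G_1$ is of type $p4$ and $H_1$ of type $p2$. For a group of type $p4$, a lattice unit is a square whose side vectors generate the translation subgroup and whose corners are centres of quarter-turns of the group (its centre is then also a centre of quarter-turns). It is oblique if its sides are neither parallel to nor at $45^\circ$ to the strands.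 Levels. An oblique $p4$ lattice unit is of level $1$ if it is the square on the hypotenuse of a right triangle with horizontal and vertical sides one odd, one even, and relatively prime. A square $Q'$ escribes a square $Q$ if the corners of $Q$ are the mid-points of the sides of $Q'$. For $n\ge 1$, a lattice unit of level $n+1$ is a square escribing a square of level $n$ (the level-$1$ square on which the construction is based has the same centre, has its corners all at cell corners or all at cell centres, and satisfies the size conditions for level $1$). *)

theory Defs
  imports "HOL-Analysis.Analysis"
begin

section \<open>Cells and strands\<close>

text \<open>The plane is \<^typ>\<open>complex\<close>, with cell corners at the points with integer coordinates.\<close>

definition cell :: "int \<Rightarrow> int \<Rightarrow> complex set" where
  "cell i j = cbox (Complex (of_int i) (of_int j)) (Complex (of_int i + 1) (of_int j + 1))"

definition cells :: "complex set set" where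
  "cells = {cell i j | i j. True}"

definition cell_corners :: "complex set" where
  "cell_corners = {Complex (of_int i) (of_int j) | i j. True}"

definition cell_centres :: "complex set" where
  "cell_centres = {Complex (of_int i + 1/2) (of_int j + 1/2) | i j. True}"

definition warp :: "int \<Rightarrow> complex set" where
  "warp i = (\<Union>j. cell i j)"

definition weft :: "int \<Rightarrow> complex set" where
  "weft j = (\<Union>i. cell i j)"

definition strands :: "complex set set" where
  "strands = range warp \<union> range weft"

definition strands_at :: "complex set \<Rightarrow> complex set set" where
  "strands_at c = {S \<in> strands. c \<subseteq> S}"


section \<open>Prefabrics and their symmetries\<close>

text \<open>A prefabric is a map sending each cell to its uppermost strand; its values on sets that
  are not cells play no role.\<close>

definition prefabric :: "(complex set \<Rightarrow> complex set) \<Rightarrow> bool" where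
  "prefabric P \<longleftrightarrow> (\<forall>c\<in>cells. P c \<in> strands_at c)"

definition lowermost :: "(complex set \<Rightarrow> complex set) \<Rightarrow> complex set \<Rightarrow> complex set" where
  "lowermost P c = (THE S. S \<in> strands_at c \<and> S \<noteq> P c)"

definition plane_isometry :: "(complex \<Rightarrow> complex) \<Rightarrow> bool" where
  "plane_isometry g \<longleftrightarrow> surj g \<and> (\<forall>x y. dist (g x) (g y) = dist x y)"

datatype side_effect = Preserve | Reverse

fun carries :: "(complex set \<Rightarrow> complex set) \<Rightarrow> (complex \<Rightarrow> complex) \<Rightarrow> side_effect \<Rightarrow> bool" where
  "carries P g Preserve \<longleftrightarrow> (\<forall>c\<in>cells. g ` P c = P (g ` c))"
| "carries P g Reverse \<longleftrightarrow> (\<forall>c\<in>cells. g ` P c = lowermost P (g ` c))"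

definition symmetry_group ::
    "(complex set \<Rightarrow> complex set) \<Rightarrow> ((complex \<Rightarrow> complex) \<times> side_effect) set" where
  "symmetry_group P = {(g, \<epsilon>). plane_isometry g \<and> (\<lambda>c. g ` c) ` cells = cells \<and> carries P g \<epsilon>}"

definition planar_group :: "(complex set \<Rightarrow> complex set) \<Rightarrow> (complex \<Rightarrow> complex) set" where
  "planar_group P = fst ` symmetry_group P"

definition side_preserving_group :: "(complex set \<Rightarrow> complex set) \<Rightarrow> (complex \<Rightarrow> complex) set" where
  "side_preserving_group P = {g. (g, Preserve) \<in> symmetry_group P}"

definition isonemal :: "(complex set \<Rightarrow> complex set) \<Rightarrow> bool" where
  "isonemal P \<longleftrightarrow> (\<forall>S\<in>strands. \<forall>T\<in>strands. \<exists>(g, \<epsilon>)\<in>symmetry_group P. g ` S = T)"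

definition repeats_every :: "(complex set \<Rightarrow> complex set) \<Rightarrow> nat \<Rightarrow> bool" where
  "repeats_every P n \<longleftrightarrow>
     (\<forall>i j. (P (cell i j) = warp i \<longleftrightarrow> P (cell i (j + int n)) = warp i) \<and>
            (P (cell i j) = weft j \<longleftrightarrow> P (cell (i + int n) j) = weft j))"

definition has_order :: "(complex set \<Rightarrow> complex set) \<Rightarrow> nat \<Rightarrow> bool" where
  "has_order P n \<longleftrightarrow>
     0 < n \<and> repeats_every P n \<and> (\<forall>m. 0 < m \<and> m < n \<longrightarrow> \<not> repeats_every P m)"


section \<open>Crystallographic types\<close>

definition translation_vectors :: "(complex \<Rightarrow> complex) set \<Rightarrow> complex set" where
  "translation_vectors \<Gamma> = {v. (\<lambda>z. z + v) \<in> \<Gamma>}"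

definition lattice_generated :: "complex \<Rightarrow> complex \<Rightarrow> complex set" where
  "lattice_generated u v = {of_int m * u + of_int n * v | m n. True}"

text \<open>A separate discreteness condition is not needed: the linear parts preserve the rank-two
  lattice of translations, so there are only finitely many of them.\<close>

definition wallpaper_group :: "(complex \<Rightarrow> complex) set \<Rightarrow> bool" where
  "wallpaper_group \<Gamma> \<longleftrightarrow>
     (\<forall>g\<in>\<Gamma>. plane_isometry g) \<and> id \<in> \<Gamma> \<and>
     (\<forall>g\<in>\<Gamma>. \<forall>h\<in>\<Gamma>. g \<circ> h \<in> \<Gamma>) \<and> (\<forall>g\<in>\<Gamma>. inv g \<in> \<Gamma>) \<and>
     (\<exists>u v. u \<noteq> v \<and> independent {u, v} \<and> translation_vectors \<Gamma> = lattice_generated u v)"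

definition point_group :: "(complex \<Rightarrow> complex) set \<Rightarrow> (complex \<Rightarrow> complex) set" where
  "point_group \<Gamma> = (\<lambda>g z. g z - g 0) ` \<Gamma>"

text \<open>A wallpaper group is of type \<open>p2\<close> or \<open>p4\<close> exactly when its point group is the cyclic group
  of rotations of order 2 or 4, respectively.\<close>

definition type_p2 :: "(complex \<Rightarrow> complex) set \<Rightarrow> bool" where
  "type_p2 \<Gamma> \<longleftrightarrow> wallpaper_group \<Gamma> \<and> point_group \<Gamma> = {(*) 1, (*) (-1)}"

definition type_p4 :: "(complex \<Rightarrow> complex) set \<Rightarrow> bool" where
  "type_p4 \<Gamma> \<longleftrightarrow> wallpaper_group \<Gamma> \<and> point_group \<Gamma> = {(*) 1, (*) \<i>, (*) (-1), (*) (-\<i>)}"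

definition symmetry_type_p4_none :: "(complex set \<Rightarrow> complex set) \<Rightarrow> bool" where
  "symmetry_type_p4_none P \<longleftrightarrow>
     type_p4 (planar_group P) \<and> side_preserving_group P = planar_group P"

definition symmetry_type_p4_p4 :: "(complex set \<Rightarrow> complex set) \<Rightarrow> bool" where
  "symmetry_type_p4_p4 P \<longleftrightarrow>
     type_p4 (planar_group P) \<and> type_p4 (side_preserving_group P) \<and>
     side_preserving_group P \<noteq> planar_group P"

definition symmetry_type_p4_p2 :: "(complex set \<Rightarrow> complex set) \<Rightarrow> bool" where
  "symmetry_type_p4_p2 P \<longleftrightarrow>
     type_p4 (planar_group P) \<and> type_p2 (side_preserving_group P)"


section \<open>Lattice units and levels\<close>

text \<open>A square is given by one of its corners and the side vector leaving that corner
  counterclockwise, so each square has four such descriptions. The notions below depend only on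
  the square described.\<close>

datatype square = Square (base_corner: complex) (side_vector: complex)

fun corners :: "square \<Rightarrow> complex set" where
  "corners (Square p s) = {p, p + s, p + s + \<i> * s, p + \<i> * s}"

fun side_midpoints :: "square \<Rightarrow> complex set" where
  "side_midpoints (Square p s) =
     {midpoint p (p + s), midpoint (p + s) (p + s + \<i> * s),
      midpoint (p + s + \<i> * s) (p + \<i> * s), midpoint (p + \<i> * s) p}"

fun centre :: "square \<Rightarrow> complex" where
  "centre (Square p s) = midpoint p (p + s + \<i> * s)"

definition quarter_turn :: "complex \<Rightarrow> complex \<Rightarrow> complex" where
  "quarter_turn c z = c + \<i> * (z - c)"

definition lattice_unit :: "(complex \<Rightarrow> complex) set \<Rightarrow> square \<Rightarrow> bool" where
  "lattice_unit \<Gamma> Q \<longleftrightarrow>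
     translation_vectors \<Gamma> = lattice_generated (side_vector Q) (\<i> * side_vector Q) \<and>
     (\<forall>p\<in>corners Q. quarter_turn p \<in> \<Gamma>)"

definition oblique :: "square \<Rightarrow> bool" where
  "oblique Q \<longleftrightarrow>
     Re (side_vector Q) \<noteq> 0 \<and> Im (side_vector Q) \<noteq> 0 \<and>
     \<bar>Re (side_vector Q)\<bar> \<noteq> \<bar>Im (side_vector Q)\<bar>"

definition level_one_size :: "square \<Rightarrow> bool" where
  "level_one_size Q \<longleftrightarrow>
     (\<exists>a b :: nat. 0 < a \<and> 0 < b \<and> coprime a b \<and> (odd a \<and> even b \<or> even a \<and> odd b) \<and>
        \<bar>Re (side_vector Q)\<bar> = real a \<and> \<bar>Im (side_vector Q)\<bar> = real b)"

definition escribes :: "square \<Rightarrow> square \<Rightarrow> bool" where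
  "escribes Q' Q \<longleftrightarrow> corners Q = side_midpoints Q'"

text \<open>The condition on the corners in the base case is there for the squares on which higher
  levels are built. For a lattice unit of level 1 of a symmetry group it holds automatically,
  since a quarter-turn preserving the cells is centred at a cell corner or a cell centre.
  Escribing preserves the centre.\<close>

inductive has_level :: "nat \<Rightarrow> square \<Rightarrow> bool" where
  one: "oblique Q \<Longrightarrow> level_one_size Q \<Longrightarrow>
        corners Q \<subseteq> cell_corners \<or> corners Q \<subseteq> cell_centres \<Longrightarrow> has_level 1 Q"
| step: "has_level n Q \<Longrightarrow> escribes Q' Q \<Longrightarrow> has_level (Suc n) Q'"

end

theory Submission
  imports Defs
begin

text \<open>The points of \<^const>\<open>cell_corners\<close> are the Gaussian integers, and the whole argument is
  arithmetic with them. A group of type \<open>p4\<close> that permutes the cells consists of maps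
  \<open>z \<mapsto> \<i>\<^sup>k z + r\<close> with \<open>r\<close> a Gaussian integer. Its translation vectors are closed under
  multiplication by \<open>\<i>\<close>, hence form an ideal \<open>(s)\<close> of the Gaussian integers, and the square with
  side vector \<open>s\<close> at any centre \<open>c\<close> of a quarter-turn is a lattice unit. Two constraints on \<open>s\<close>
  remain to be found.

  Transitivity on strands bounds the power of \<open>1 + \<i>\<close> in \<open>s\<close>. Warps are permuted only by
  translations and half-turns. Translations move a warp by multiples of \<open>d = gcd (Re s) (Im s)\<close>, and
  half-turns reflect the sequence of warps, so the warps form a single orbit only if \<open>d = 1\<close>, or if
  \<open>d = 2\<close> and the reflection interchanges even and odd warps; the latter forces \<open>c\<close> to be a cell
  corner (\<open>isonemal_gcd\<close>). Consequently \<open>s = (1 + \<i>)\<^sup>k s'\<close> with \<open>k \<le> 3\<close>, where \<open>s'\<close> has coprime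
  components of opposite parity, and \<open>k \<ge> 2\<close> only when \<open>d = 2\<close> (\<open>gaussian_factorization\<close>).
  Escribing a square multiplies its side vector by \<open>1 + \<i>\<close> up to a choice of corner, so the lattice
  unit has level \<open>k + 1\<close> as soon as the square of the same centre with side \<open>s'\<close> has level 1
  (\<open>has_level_power\<close>, \<open>has_level_one\<close>). For \<open>k \<ge> 2\<close>, both \<open>c\<close> and \<open>s / 2\<close> are Gaussian integers,
  so the centre of the unit is a cell corner.

  The hypothesis on the order makes \<open>s'\<close> oblique. Otherwise \<open>s'\<close> is a unit, \<open>s\<close> divides
  \<open>(1 + \<i>)\<^sup>3\<close>, and \<open>4\<close> is, up to a unit, \<open>1 + \<i>\<close> times a translation vector \<open>w\<close>. The quarter-turn
  conjugates the translation by \<open>w\<close> to that by \<open>\<i> w\<close>, so the two have the same effect on the sides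
  of the plane and their product is side-preserving. The pattern then repeats every 4 cells in both
  directions (\<open>repeats_every_4\<close>).\<close>

section \<open>Gaussian integers\<close>

lemma cell_corners_iff: "z \<in> cell_corners \<longleftrightarrow> Re z \<in> \<int> \<and> Im z \<in> \<int>"
  unfolding cell_corners_def Ints_def by (auto simp: complex_eq_iff)

lemma cell_corners_mult: "x \<in> cell_corners \<Longrightarrow> y \<in> cell_corners \<Longrightarrow> x * y \<in> cell_corners"
  by (simp add: cell_corners_iff)

lemma cell_corners_cnj: "x \<in> cell_corners \<Longrightarrow> cnj x \<in> cell_corners"
  by (simp add: cell_corners_iff)

lemma cell_corners_one_plus_i_power: "(1 + \<i>) ^ k \<in> cell_corners"
  by (induction k) (auto simp: cell_corners_iff)

text \<open>A quarter-turn \<open>z \<mapsto> \<i> * z + t\<close> has centre \<open>t / (1 - \<i>) = t * (1 + \<i>) / 2\<close>, and the centre of a square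
  differs from its base corner by the same multiple of the side vector. Since \<open>1 + \<i>\<close> divides
  \<open>a + b * \<i>\<close> exactly when \<open>a + b\<close> is even, parity tells cell corners from cell centres.\<close>

lemma half_one_plus_i_multiple:
  assumes "z = Complex (of_int a) (of_int b)"
  shows "even (a + b) \<Longrightarrow> z * (1 + \<i>) / 2 \<in> cell_corners"
    and "odd (a + b) \<Longrightarrow> z * (1 + \<i>) / 2 \<in> cell_centres"
proof -
  assume "even (a + b)"
  then obtain q where q: "a + b = 2 * q" by blast
  then have "b = 2 * q - a" by simp
  then have "z * (1 + \<i>) / 2 = Complex (of_int (a - q)) (of_int q)"
    by (simp add: assms complex_eq_iff)
  then show "z * (1 + \<i>) / 2 \<in> cell_corners"
    unfolding cell_corners_def by blast
next
  assume "odd (a + b)"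
  then obtain q where q: "a + b = 2 * q + 1" using oddE by blast
  then have "b = 2 * q + 1 - a" by simp
  then have "z * (1 + \<i>) / 2 = Complex (of_int (a - q - 1) + 1 / 2) (of_int q + 1 / 2)"
    by (simp add: assms complex_eq_iff field_simps)
  then show "z * (1 + \<i>) / 2 \<in> cell_centres"
    unfolding cell_centres_def by blast
qed

text \<open>The Euclidean argument: a nonzero element of least norm generates, because rounding a quotient to
  the nearest Gaussian integer leaves a remainder of at most half the norm of the divisor.\<close>

lemma gaussian_ideal_principal:
  assumes int: "L \<subseteq> cell_corners"
    and add: "\<And>x y. x \<in> L \<Longrightarrow> y \<in> L \<Longrightarrow> x + y \<in> L"
    and mult: "\<And>q x. q \<in> cell_corners \<Longrightarrow> x \<in> L \<Longrightarrow> q * x \<in> L"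
    and w: "w \<in> L" "w \<noteq> 0"
  obtains s where "s \<in> L" "L = lattice_generated s (\<i> * s)"
proof -
  have norm_int: "\<exists>m::nat. (cmod z)\<^sup>2 = real m" if "z \<in> L" for z
  proof -
    obtain a b where "z = Complex (of_int a) (of_int b)"
      using \<open>z \<in> L\<close> int unfolding cell_corners_def by blast
    then have "(cmod z)\<^sup>2 = real (nat (a\<^sup>2 + b\<^sup>2))"
      by (simp add: cmod_power2)
    then show ?thesis by blast
  qed
  define N where "N z = nat \<lfloor>(cmod z)\<^sup>2\<rfloor>" for z
  have N: "real (N z) = (cmod z)\<^sup>2" if "z \<in> L" for z
  proof -
    obtain m where "(cmod z)\<^sup>2 = real m" using norm_int[OF \<open>z \<in> L\<close>] by blast
    then show ?thesis by (simp add: N_def)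
  qed
  obtain s where s: "s \<in> L" "s \<noteq> 0" and least: "\<And>z. z \<in> L \<Longrightarrow> z \<noteq> 0 \<Longrightarrow> N s \<le> N z"
    using ex_has_least_nat[of "\<lambda>z. z \<in> L \<and> z \<noteq> 0" w N] w by blast
  have "v \<in> lattice_generated s (\<i> * s)" if v: "v \<in> L" for v
  proof -
    define m n where "m = round (Re (v / s))" and "n = round (Im (v / s))"
    define q where "q = Complex (of_int m) (of_int n)"
    define r where "r = v + (- q) * s"
    have "- q \<in> cell_corners" by (simp add: q_def cell_corners_iff)
    then have rL: "r \<in> L" unfolding r_def using add mult v s by blast
    have "\<bar>Re (v / s) - of_int m\<bar> \<le> 1 / 2" "\<bar>Im (v / s) - of_int n\<bar> \<le> 1 / 2"
      unfolding m_def n_def using of_int_round_abs_le by (metis abs_minus_commute)+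
    then have "\<bar>Re (v / s) - of_int m\<bar>\<^sup>2 \<le> (1 / 2)\<^sup>2" "\<bar>Im (v / s) - of_int n\<bar>\<^sup>2 \<le> (1 / 2)\<^sup>2"
      by (intro power_mono; simp)+
    then have "(cmod (v / s - q))\<^sup>2 \<le> 1 / 2"
      unfolding cmod_power2 q_def by (simp add: power2_eq_square)
    moreover have "r = (v / s - q) * s"
      using s by (simp add: r_def field_simps)
    ultimately have "(cmod r)\<^sup>2 \<le> 1 / 2 * (cmod s)\<^sup>2"
      by (simp only: norm_mult power_mult_distrib) (rule mult_right_mono, simp_all)
    moreover have "(cmod s)\<^sup>2 > 0" using s by simp
    ultimately have "(cmod r)\<^sup>2 < (cmod s)\<^sup>2" by linarith
    then have "N r < N s" using N[OF rL] N[OF s(1)] by linarith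
    then have "r = 0" using least[OF rL] by fastforce
    then have "v = of_int m * s + of_int n * (\<i> * s)"
      by (simp add: r_def q_def Complex_eq algebra_simps)
    then show ?thesis unfolding lattice_generated_def by blast
  qed
  moreover have "of_int m * s + of_int n * (\<i> * s) \<in> L" for m n
  proof -
    have "Complex (of_int m) (of_int n) * s \<in> L"
      by (rule mult) (simp_all add: s cell_corners_iff)
    then show ?thesis by (simp add: Complex_eq algebra_simps)
  qed
  ultimately have "L = lattice_generated s (\<i> * s)"
    unfolding lattice_generated_def by blast
  then show ?thesis using that s by blast
qed

text \<open>If both components are odd, \<open>1 + \<i>\<close> divides exactly once: a second factor would make both even.\<close>

lemma primitive_gaussian_factorization:
  assumes "coprime a b"
  obtains a' b' :: int and e :: nat where "e \<le> 1" "coprime a' b'" "odd (a' + b')"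
    "Complex (of_int a) (of_int b) = (1 + \<i>) ^ e * Complex (of_int a') (of_int b')"
proof (cases "odd (a + b)")
  case True
  then show ?thesis using that[of 0 a b] assms by simp
next
  case False
  then have odd: "odd a" "odd b"
    using assms by (auto simp: coprime_def)
  define a' b' where "a' = (a + b) div 2" and "b' = (b - a) div 2"
  have ab: "a = a' - b'" "b = a' + b'"
    using odd by (auto simp: a'_def b'_def elim!: oddE)
  have "coprime a' b'"
    using assms unfolding ab by (meson coprime_def dvd_add dvd_diff)
  moreover have "odd (a' + b')" using odd ab by simp
  moreover have "Complex (of_int a) (of_int b) = (1 + \<i>) ^ 1 * Complex (of_int a') (of_int b')"
    by (simp add: ab complex_eq_iff)
  ultimately show ?thesis using that[of 1 a' b'] by simp
qed

text \<open>The number 2 contributes two further factors, being \<open>(1 + \<i>)\<^sup>2\<close> up to a unit.\<close>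

lemma gaussian_factorization:
  assumes "gcd a b = 1 \<or> gcd a b = 2"
  obtains a' b' :: int and k :: nat where "k \<le> 3" "coprime a' b'" "odd (a' + b')"
    "Complex (of_int a) (of_int b) = (1 + \<i>) ^ k * Complex (of_int a') (of_int b')"
    "k \<ge> 2 \<Longrightarrow> gcd a b = 2"
proof (cases "gcd a b = 1")
  case True
  then have "coprime a b" by (simp add: coprime_iff_gcd_eq_1)
  then obtain a' b' e where "e \<le> (1::nat)" "coprime a' b'" "odd (a' + b')"
    "Complex (of_int a) (of_int b) = (1 + \<i>) ^ e * Complex (of_int a') (of_int b')"
    using primitive_gaussian_factorization by metis
  then show ?thesis using that[of e a' b'] by simp
next
  case False
  then have g: "gcd a b = 2" using assms by blast
  obtain a1 b1 where ab: "a = 2 * a1" "b = 2 * b1"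
    using g by (metis dvd_def gcd_dvd1 gcd_dvd2)
  have "coprime a1 b1"
    using g unfolding ab by (simp add: coprime_iff_gcd_eq_1 gcd_mult_left)
  then have "coprime b1 (- a1)" by (simp add: coprime_commute)
  then obtain a' b' e where e: "e \<le> (1::nat)" "coprime a' b'" "odd (a' + b')"
    "Complex (of_int b1) (of_int (- a1)) = (1 + \<i>) ^ e * Complex (of_int a') (of_int b')"
    using primitive_gaussian_factorization by metis
  \<comment> \<open>Since \<open>2 = (1 + \<i>)\<^sup>2 * (- \<i>)\<close>, halving and turning by \<open>- \<i>\<close> gives the cofactor.\<close>
  have "Complex (of_int a) (of_int b) = (1 + \<i>) ^ 2 * Complex (of_int b1) (of_int (- a1))"
    by (simp add: ab complex_eq_iff power2_eq_square)
  also have "\<dots> = (1 + \<i>) ^ (2 + e) * Complex (of_int a') (of_int b')"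
    by (simp only: e(4) power_add mult.assoc)
  finally show ?thesis using that[of "2 + e" a' b'] e g by simp
qed


section \<open>Cells and strands\<close>

lemma in_cell: "z \<in> cell i j \<longleftrightarrow>
    of_int i \<le> Re z \<and> Re z \<le> of_int i + 1 \<and> of_int j \<le> Im z \<and> Im z \<le> of_int j + 1"
  by (auto simp: cell_def in_cbox_complex_iff)

lemma ex_unit_interval: "\<exists>j::int. of_int j \<le> y \<and> y \<le> of_int j + (1::real)"
  by (rule exI[of _ "\<lfloor>y\<rfloor>"]) (simp add: real_of_int_floor_add_one_ge)

lemma in_warp: "z \<in> warp i \<longleftrightarrow> of_int i \<le> Re z \<and> Re z \<le> of_int i + 1"
  using ex_unit_interval[of "Im z"] by (auto simp: warp_def in_cell)

lemma in_weft: "z \<in> weft j \<longleftrightarrow> of_int j \<le> Im z \<and> Im z \<le> of_int j + 1"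
  using ex_unit_interval[of "Re z"] by (auto simp: weft_def in_cell)

lemma cell_subset_warp: "cell i j \<subseteq> warp k \<longleftrightarrow> k = i"
proof
  assume "cell i j \<subseteq> warp k"
  moreover have "Complex (of_int i) (of_int j) \<in> cell i j"
    "Complex (of_int i + 1) (of_int j) \<in> cell i j" by (auto simp: in_cell)
  ultimately have "Complex (of_int i) (of_int j) \<in> warp k"
    "Complex (of_int i + 1) (of_int j) \<in> warp k" by auto
  then show "k = i" by (simp add: in_warp)
qed (auto simp: in_cell in_warp)

lemma cell_subset_weft: "cell i j \<subseteq> weft k \<longleftrightarrow> k = j"
proof
  assume "cell i j \<subseteq> weft k"
  moreover have "Complex (of_int i) (of_int j) \<in> cell i j"
    "Complex (of_int i) (of_int j + 1) \<in> cell i j" by (auto simp: in_cell)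
  ultimately have "Complex (of_int i) (of_int j) \<in> weft k"
    "Complex (of_int i) (of_int j + 1) \<in> weft k" by auto
  then show "k = j" by (simp add: in_weft)
qed (auto simp: in_cell in_weft)

lemma strands_at_cell: "strands_at (cell i j) = {warp i, weft j}"
proof -
  have "S \<in> strands \<and> cell i j \<subseteq> S \<longleftrightarrow> S = warp i \<or> S = weft j" for S
  proof -
    have "S \<in> strands \<longleftrightarrow> (\<exists>k. S = warp k) \<or> (\<exists>k. S = weft k)"
      by (auto simp: strands_def)
    then show ?thesis using cell_subset_warp[of i j] cell_subset_weft[of i j] by metis
  qed
  then show ?thesis by (auto simp: strands_at_def)
qed

lemma warp_neq_weft: "warp i \<noteq> weft j"
proof
  assume "warp i = weft j"
  moreover have "Complex (of_int i) (of_int j + 2) \<in> warp i" by (simp add: in_warp)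
  ultimately show False by (simp add: in_weft)
qed

lemma prefabric_cases:
  assumes "prefabric P"
  shows "P (cell i j) = warp i \<and> lowermost P (cell i j) = weft j \<or>
         P (cell i j) = weft j \<and> lowermost P (cell i j) = warp i"
proof -
  have "cell i j \<in> cells" by (auto simp: cells_def)
  then have "P (cell i j) \<in> {warp i, weft j}"
    using assms unfolding prefabric_def strands_at_cell[symmetric] by blast
  then show ?thesis
    unfolding lowermost_def strands_at_cell
    using warp_neq_weft[of i j] by (auto intro!: the_equality)
qed

lemma translation_images:
  fixes a b :: int
  defines "g \<equiv> \<lambda>z. z + Complex (of_int a) (of_int b)"
  shows "g ` cell i j = cell (i + a) (j + b)"
    and "g ` warp i = warp (i + a)" and "g ` weft j = weft (j + b)"
proof -
  have eq: "g ` A = {z. z - Complex (of_int a) (of_int b) \<in> A}" for A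
    unfolding g_def by force
  show "g ` cell i j = cell (i + a) (j + b)" unfolding eq by (auto simp: in_cell)
  show "g ` warp i = warp (i + a)" unfolding eq by (auto simp: in_warp)
  show "g ` weft j = weft (j + b)" unfolding eq by (auto simp: in_weft)
qed

lemma quarter_turn_images:
  fixes a b :: int
  defines "g \<equiv> \<lambda>z. \<i> * z + Complex (of_int a) (of_int b)"
  shows "g ` cell i j = cell (a - j - 1) (i + b)"
    and "g ` warp i = weft (i + b)" and "g ` weft j = warp (a - j - 1)"
proof -
  have eq: "g ` A = {z. - \<i> * (z - Complex (of_int a) (of_int b)) \<in> A}" for A
  proof -
    have "z = g (- \<i> * (z - Complex (of_int a) (of_int b)))" for z
      unfolding g_def by (simp add: complex_eq_iff)
    moreover have "- \<i> * (g z - Complex (of_int a) (of_int b)) = z" for z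
      unfolding g_def by (simp add: complex_eq_iff)
    ultimately show ?thesis by (auto simp: image_iff)
  qed
  show "g ` cell i j = cell (a - j - 1) (i + b)" unfolding eq by (auto simp: in_cell)
  show "g ` warp i = weft (i + b)" unfolding eq by (auto simp: in_warp in_weft)
  show "g ` weft j = warp (a - j - 1)" unfolding eq by (auto simp: in_warp in_weft)
qed


section \<open>The group of planar parts\<close>

lemma planar_group_permutes_cells:
  assumes "g \<in> planar_group P"
  shows "\<exists>a b. g ` cell i j = cell a b"
proof -
  have "(\<lambda>c. g ` c) ` cells = cells"
    using assms unfolding planar_group_def symmetry_group_def by auto
  moreover have "cell i j \<in> cells" by (auto simp: cells_def)
  ultimately have "g ` cell i j \<in> cells" by blast
  then show ?thesis by (auto simp: cells_def)
qed

text \<open>Opposite corners of a cell differ by 1 in each coordinate, so their images in another cell must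
  be its opposite corners; this pins down the image of the origin.\<close>

lemma planar_translation_integral:
  assumes "(\<lambda>z. z + t) \<in> planar_group P"
  shows "t \<in> cell_corners"
proof -
  obtain a b where ab: "(\<lambda>z. z + t) ` cell 0 0 = cell a b"
    using planar_group_permutes_cells[OF assms] by blast
  have "0 \<in> cell 0 0" "1 + \<i> \<in> cell 0 0" by (auto simp: in_cell)
  then have "0 + t \<in> cell a b" "1 + \<i> + t \<in> cell a b" unfolding ab[symmetric] by blast+
  then have "t = Complex (of_int a) (of_int b)" by (auto simp: in_cell complex_eq_iff)
  then show ?thesis by (auto simp: cell_corners_def)
qed

lemma planar_quarter_turn_integral:
  assumes "(\<lambda>z. \<i> * z + t) \<in> planar_group P"
  shows "t \<in> cell_corners"
proof -
  obtain a b where ab: "(\<lambda>z. \<i> * z + t) ` cell 0 0 = cell a b"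
    using planar_group_permutes_cells[OF assms] by blast
  have "0 \<in> cell 0 0" "1 + \<i> \<in> cell 0 0" by (auto simp: in_cell)
  then have "\<i> * 0 + t \<in> cell a b" "\<i> * (1 + \<i>) + t \<in> cell a b" unfolding ab[symmetric] by blast+
  then have "t = Complex (of_int (a + 1)) (of_int b)" by (auto simp: in_cell complex_eq_iff)
  then show ?thesis unfolding cell_corners_def by blast
qed

lemma p4_group_axioms:
  assumes "type_p4 \<Gamma>"
  shows "\<And>g h. g \<in> \<Gamma> \<Longrightarrow> h \<in> \<Gamma> \<Longrightarrow> g \<circ> h \<in> \<Gamma>" "\<And>g. g \<in> \<Gamma> \<Longrightarrow> inv g \<in> \<Gamma>" "\<And>g. g \<in> \<Gamma> \<Longrightarrow> surj g"
  using assms unfolding type_p4_def wallpaper_group_def plane_isometry_def by auto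

lemma p4_quarter_turn_exists:
  assumes "type_p4 \<Gamma>"
  obtains t where "(\<lambda>z. \<i> * z + t) \<in> \<Gamma>"
proof -
  have "(*) \<i> \<in> point_group \<Gamma>" using assms by (simp add: type_p4_def)
  then obtain g where g: "g \<in> \<Gamma>" "(*) \<i> = (\<lambda>z. g z - g 0)"
    unfolding point_group_def by blast
  have "g z = \<i> * z + g 0" for z using fun_cong[OF g(2), of z] by simp
  then have "g = (\<lambda>z. \<i> * z + g 0)" by blast
  then show ?thesis using that g(1) by metis
qed

lemma p4_element_form:
  assumes "type_p4 \<Gamma>" "g \<in> \<Gamma>"
  obtains u t where "u \<in> {1, \<i>, -1, -\<i>}" "g = (\<lambda>z. u * z + t)"
proof -
  have "(\<lambda>z. g z - g 0) \<in> point_group \<Gamma>" using assms unfolding point_group_def by blast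
  then obtain u where u: "u \<in> {1, \<i>, -1, -\<i>}" "(\<lambda>z. g z - g 0) = (*) u"
    using assms unfolding type_p4_def by blast
  have "g z = u * z + g 0" for z using fun_cong[OF u(2), of z] by (simp add: algebra_simps)
  then have "g = (\<lambda>z. u * z + g 0)" by blast
  then show ?thesis using that u(1) by metis
qed

lemma translation_vectors_add:
  assumes "type_p4 \<Gamma>" "v \<in> translation_vectors \<Gamma>" "w \<in> translation_vectors \<Gamma>"
  shows "v + w \<in> translation_vectors \<Gamma>"
proof -
  have "(\<lambda>z. z + w) \<circ> (\<lambda>z. z + v) \<in> \<Gamma>"
    using assms p4_group_axioms(1) unfolding translation_vectors_def by blast
  then show ?thesis by (simp add: translation_vectors_def o_def add.assoc)
qed

text \<open>Conjugation by a quarter-turn turns a translation vector through a right angle.\<close>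

lemma translation_vectors_i:
  assumes "type_p4 \<Gamma>" "v \<in> translation_vectors \<Gamma>"
  shows "\<i> * v \<in> translation_vectors \<Gamma>"
proof -
  obtain t where h: "(\<lambda>z. \<i> * z + t) \<in> \<Gamma>" (is "?h \<in> _")
    using assms p4_quarter_turn_exists by blast
  have "(\<lambda>z. z + v) \<in> \<Gamma>" using assms(2) by (simp add: translation_vectors_def)
  then have "(?h \<circ> (\<lambda>z. z + v)) \<circ> inv ?h \<in> \<Gamma>"
    by (intro p4_group_axioms(1,2)[OF assms(1)] h)
  moreover have "((?h \<circ> (\<lambda>z. z + v)) \<circ> inv ?h) z = z + \<i> * v" for z
  proof -
    define y where "y = inv ?h z"
    have "\<i> * y + t = z"
      unfolding y_def by (rule surj_f_inv_f[OF p4_group_axioms(3)[OF assms(1) h]])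
    moreover have "((?h \<circ> (\<lambda>z. z + v)) \<circ> inv ?h) z = \<i> * (y + v) + t"
      by (simp only: y_def o_apply)
    ultimately show ?thesis by (simp add: algebra_simps)
  qed
  then have "(?h \<circ> (\<lambda>z. z + v)) \<circ> inv ?h = (\<lambda>z. z + \<i> * v)" by (rule ext)
  ultimately show ?thesis by (simp add: translation_vectors_def)
qed

lemma translation_vectors_mult:
  assumes "type_p4 \<Gamma>" "q \<in> cell_corners" "v \<in> translation_vectors \<Gamma>"
  shows "q * v \<in> translation_vectors \<Gamma>"
proof -
  have int: "of_int m * w \<in> translation_vectors \<Gamma>" if w: "w \<in> translation_vectors \<Gamma>" for m w
  proof -
    obtain u u' where L: "translation_vectors \<Gamma> = lattice_generated u u'"
      using assms(1) unfolding type_p4_def wallpaper_group_def by blast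
    obtain a b where "w = of_int a * u + of_int b * u'"
      using w unfolding L lattice_generated_def by blast
    then have "of_int m * w = of_int (m * a) * u + of_int (m * b) * u'"
      by (simp add: algebra_simps)
    then show ?thesis unfolding L lattice_generated_def by blast
  qed
  \<comment> \<open>Closure under integers and \<open>\<i>\<close> is closure under all Gaussian integers.\<close>
  obtain a b where q: "q = Complex (of_int a) (of_int b)"
    using assms(2) unfolding cell_corners_def by blast
  have "of_int a * v + of_int b * (\<i> * v) \<in> translation_vectors \<Gamma>"
    using int translation_vectors_add[OF assms(1)] translation_vectors_i[OF assms(1)] assms(3)
    by blast
  then show ?thesis by (simp add: q Complex_eq algebra_simps)
qed

lemma planar_p4_lattice_principal:
  assumes "type_p4 (planar_group P)"
  obtains s where "s \<in> translation_vectors (planar_group P)"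
    "translation_vectors (planar_group P) = lattice_generated s (\<i> * s)"
proof -
  let ?L = "translation_vectors (planar_group P)"
  obtain u v where uv: "independent {u, v}" "?L = lattice_generated u v"
    using assms unfolding type_p4_def wallpaper_group_def by blast
  have "u \<noteq> 0" using uv(1) dependent_zero by blast
  have "u = of_int 1 * u + of_int 0 * v" by simp
  then have "u \<in> ?L" unfolding uv(2) lattice_generated_def by blast
  have "?L \<subseteq> cell_corners"
    using planar_translation_integral by (auto simp: translation_vectors_def)
  from gaussian_ideal_principal[OF this translation_vectors_add[OF assms]
      translation_vectors_mult[OF assms] \<open>u \<in> ?L\<close> \<open>u \<noteq> 0\<close>] that
  show ?thesis by blast
qed

text \<open>The square of the quarter-turn is a half-turn, and two half-turns differ by a translation.\<close>

lemma half_turn_translation_part: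
  assumes "type_p4 \<Gamma>" "(\<lambda>z. \<i> * z + t) \<in> \<Gamma>" "(\<lambda>z. - z + r) \<in> \<Gamma>"
  shows "r - (1 + \<i>) * t \<in> translation_vectors \<Gamma>"
proof -
  let ?h = "(\<lambda>z. \<i> * z + t) \<circ> (\<lambda>z. \<i> * z + t)"
  have h: "?h \<in> \<Gamma>" by (intro p4_group_axioms(1)[OF assms(1)] assms(2))
  have "(\<lambda>z. - z + r) \<circ> inv ?h \<in> \<Gamma>" by (intro p4_group_axioms(1,2)[OF assms(1)] assms(3) h)
  moreover have "((\<lambda>z. - z + r) \<circ> inv ?h) z = z + (r - (1 + \<i>) * t)" for z
  proof -
    define y where "y = inv ?h z"
    have "?h y = z"
      unfolding y_def by (rule surj_f_inv_f[OF p4_group_axioms(3)[OF assms(1) h]])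
    then have "z = (1 + \<i>) * t - y" by (simp add: algebra_simps)
    moreover have "((\<lambda>z. - z + r) \<circ> inv ?h) z = - y + r"
      by (simp only: y_def o_apply[of "\<lambda>z. - z + r"])
    ultimately show ?thesis by simp
  qed
  then have "(\<lambda>z. - z + r) \<circ> inv ?h = (\<lambda>z. z + (r - (1 + \<i>) * t))" by (rule ext)
  ultimately show ?thesis by (simp add: translation_vectors_def)
qed

text \<open>Following the quarter-turn about \<open>c\<close> by the translation by \<open>(1 - \<i>) * v\<close> gives the quarter-turn
  about \<open>c + v\<close>, so every translate of a quarter-turn centre by a lattice vector is again one.\<close>

lemma lattice_unit_at_quarter_turn:
  assumes "type_p4 \<Gamma>" "(\<lambda>z. \<i> * z + t) \<in> \<Gamma>"
    and s: "s \<in> translation_vectors \<Gamma>" "translation_vectors \<Gamma> = lattice_generated s (\<i> * s)"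
  shows "lattice_unit \<Gamma> (Square (t * (1 + \<i>) / 2) s)"
proof -
  let ?c = "t * (1 + \<i>) / 2"
  have turn: "quarter_turn (?c + q * s) \<in> \<Gamma>" if "q \<in> cell_corners" for q
  proof -
    have "(1 - \<i>) * q \<in> cell_corners"
      using that by (intro cell_corners_mult) (simp_all add: cell_corners_iff)
    then have "(1 - \<i>) * q * s \<in> translation_vectors \<Gamma>"
      by (intro translation_vectors_mult[OF assms(1)] s(1))
    then have "(\<lambda>z. z + (1 - \<i>) * q * s) \<circ> (\<lambda>z. \<i> * z + t) \<in> \<Gamma>"
      by (intro p4_group_axioms(1)[OF assms(1)] assms(2)) (simp add: translation_vectors_def)
    also have "(\<lambda>z. z + (1 - \<i>) * q * s) \<circ> (\<lambda>z. \<i> * z + t) = quarter_turn (?c + q * s)"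
      by (rule ext) (simp add: quarter_turn_def complex_eq_iff field_simps)
    finally show ?thesis .
  qed
  show ?thesis
    unfolding lattice_unit_def
    using s turn[of 0] turn[of 1] turn[of "1 + \<i>"] turn[of \<i>]
    by (simp add: cell_corners_iff algebra_simps)
qed


section \<open>Transitivity on strands\<close>

text \<open>The points \<open>2 * \<i>\<close> and \<open>- 2 * \<i>\<close> of the warp through the origin rule out quarter-turns, since their images
  under one lie too far apart horizontally to belong to the same warp. For half-turns the index
  differs by one from the real part of the translation, as a warp is named by its left edge.\<close>

lemma warp_to_warp:
  assumes "u \<in> {1, \<i>, -1, -\<i>}" "(\<lambda>z. u * z + t) ` warp 0 = warp j"
  shows "u = 1 \<and> Re t = of_int j \<or> u = -1 \<and> Re t = of_int (j + 1)"
proof -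
  have img: "u * z + t \<in> warp j" if "z \<in> warp 0" for z
    using that assms(2) by blast
  have "0 \<in> warp 0" "1 \<in> warp 0" "Complex 0 2 \<in> warp 0" "Complex 0 (-2) \<in> warp 0"
    by (auto simp: in_warp)
  from this[THEN img] assms(1) show ?thesis by (auto simp: in_warp)
qed

text \<open>Translations shift the indices of warps by multiples of \<open>d = gcd a b\<close>, and half-turns send warp
  \<open>0\<close> to indices congruent to \<open>p - q - 1\<close> modulo \<open>d\<close>. These two residue classes cover all integers
  only if \<open>d \<le> 2\<close>, and for \<open>d = 2\<close> the second class must be that of the odd numbers.\<close>

lemma isonemal_gcd:
  assumes iso: "isonemal P" and p4: "type_p4 (planar_group P)"
    and t: "(\<lambda>z. \<i> * z + Complex (of_int p) (of_int q)) \<in> planar_group P"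
    and L: "translation_vectors (planar_group P) =
            lattice_generated (Complex (of_int a) (of_int b)) (\<i> * Complex (of_int a) (of_int b))"
  shows "gcd a b = 1 \<or> gcd a b = 2 \<and> even (p + q)"
proof -
  let ?d = "gcd a b"
  have Re_L: "?d dvd m" if v: "v \<in> translation_vectors (planar_group P)" "Re v = of_int m" for v m
  proof -
    obtain k l where "v = of_int k * Complex (of_int a) (of_int b) +
        of_int l * (\<i> * Complex (of_int a) (of_int b))"
      using v(1) unfolding L lattice_generated_def by blast
    then have "of_int m = (of_int (k * a - l * b) :: real)" using v(2) by simp
    then have "m = k * a - l * b" using of_int_eq_iff by blast
    then show ?thesis by simp
  qed
  have key: "?d dvd j \<or> ?d dvd j + 1 - (p - q)" for j
  proof -
    have "warp 0 \<in> strands" "warp j \<in> strands" by (auto simp: strands_def)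
    then obtain x where x: "x \<in> symmetry_group P" "case x of (g, \<epsilon>) \<Rightarrow> g ` warp 0 = warp j"
      using iso unfolding isonemal_def by blast
    define g where "g = fst x"
    have g: "g \<in> planar_group P" "g ` warp 0 = warp j"
      using x by (auto simp: g_def planar_group_def case_prod_beta)
    obtain u r where u: "u \<in> {1, \<i>, -1, -\<i>}" and gu: "g = (\<lambda>z. u * z + r)"
      using p4_element_form[OF p4 g(1)] by metis
    from warp_to_warp[OF u g(2)[unfolded gu]] show ?thesis
    proof
      assume *: "u = 1 \<and> Re r = of_int j"
      then have "r \<in> translation_vectors (planar_group P)"
        using g(1) gu by (simp add: translation_vectors_def)
      then show ?thesis using Re_L * by blast
    next
      assume *: "u = -1 \<and> Re r = of_int (j + 1)"
      then have "(\<lambda>z. - z + r) \<in> planar_group P" using g(1) gu by simp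
      from Re_L[OF half_turn_translation_part[OF p4 t this], of "j + 1 - (p - q)"] *
      show ?thesis by simp
    qed
  qed
  show ?thesis
  proof (cases "?d = 1")
    case False
    then have "\<not> ?d dvd 1" by (metis abs_gcd_int zdvd1_eq)
    \<comment> \<open>Warps 1 and 2 cannot both be reached by half-turns, since \<open>d\<close> does not divide their
       distance; warp 1 is not reached by a translation, so warp 2 is.\<close>
    then have 1: "?d dvd 2 - (p - q)" using key[of 1] by simp
    have "\<not> ?d dvd 3 - (p - q)"
    proof
      assume "?d dvd 3 - (p - q)"
      then have "?d dvd (3 - (p - q)) - (2 - (p - q))" using 1 by (rule dvd_diff)
      then show False using \<open>\<not> ?d dvd 1\<close> by simp
    qed
    then have "?d dvd 2" using key[of 2] by simp
    then have "?d \<le> 2" by (rule zdvd_imp_le) simp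
    moreover have "?d \<noteq> 0" using \<open>?d dvd 2\<close> by (metis dvd_0_left_iff zero_neq_numeral)
    moreover have "?d \<ge> 0" by simp
    ultimately have d: "?d = 2" using False by linarith
    then have "even (p + q)" using 1 by simp
    then show ?thesis using d by blast
  qed simp
qed


section \<open>The order\<close>

text \<open>Recording a prefabric as a two-colouring of the integer grid turns the composition of
  symmetries into propositional logic on the effects.\<close>

definition warp_up :: "(complex set \<Rightarrow> complex set) \<Rightarrow> int \<Rightarrow> int \<Rightarrow> bool" where
  "warp_up P i j \<longleftrightarrow> P (cell i j) = warp i"

lemma lowermost_eq_warp_iff:
  assumes "prefabric P"
  shows "lowermost P (cell i j) = warp i \<longleftrightarrow> \<not> warp_up P i j"
  unfolding warp_up_def using prefabric_cases[OF assms, of i j] warp_neq_weft by metis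

lemma not_warp_up_iff:
  assumes "prefabric P"
  shows "\<not> warp_up P i j \<longleftrightarrow> P (cell i j) = weft j"
  unfolding warp_up_def using prefabric_cases[OF assms, of i j] warp_neq_weft by metis

lemma carries_cell:
  assumes "(g, \<epsilon>) \<in> symmetry_group P"
  shows "g ` P (cell i j) =
    (if \<epsilon> = Preserve then P (g ` cell i j) else lowermost P (g ` cell i j))"
proof -
  have "cell i j \<in> cells" by (auto simp: cells_def)
  then show ?thesis using assms by (cases \<epsilon>) (simp_all add: symmetry_group_def)
qed

lemma warp_up_translation:
  assumes P: "prefabric P"
    and g: "(\<lambda>z. z + Complex (of_int a) (of_int b), \<epsilon>) \<in> symmetry_group P"
  shows "warp_up P (i + a) (j + b) \<longleftrightarrow> (warp_up P i j \<longleftrightarrow> \<epsilon> = Preserve)"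
proof -
  have "(\<lambda>z. z + Complex (of_int a) (of_int b)) ` P (cell i j) = warp (i + a) \<longleftrightarrow> warp_up P i j"
  proof (cases "warp_up P i j")
    case True
    then show ?thesis by (simp add: warp_up_def translation_images)
  next
    case False
    then have "P (cell i j) = weft j" using not_warp_up_iff[OF P] by blast
    then show ?thesis using False by (simp add: translation_images warp_neq_weft[symmetric])
  qed
  then show ?thesis
    using carries_cell[OF g, of i j] lowermost_eq_warp_iff[OF P, of "i + a" "j + b"]
    by (auto simp: translation_images warp_up_def split: if_splits)
qed

text \<open>Here the roles of the two effects are exchanged compared with a translation, since a quarter-turn
  interchanges warps and wefts.\<close>

lemma warp_up_quarter_turn:
  assumes P: "prefabric P"
    and g: "(\<lambda>z. \<i> * z + Complex (of_int a) (of_int b), \<epsilon>) \<in> symmetry_group P"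
  shows "warp_up P (a - j - 1) (i + b) \<longleftrightarrow> (warp_up P i j \<longleftrightarrow> \<epsilon> = Reverse)"
proof -
  have "(\<lambda>z. \<i> * z + Complex (of_int a) (of_int b)) ` P (cell i j) = warp (a - j - 1) \<longleftrightarrow>
      \<not> warp_up P i j"
  proof (cases "warp_up P i j")
    case True
    then show ?thesis
      by (simp add: warp_up_def quarter_turn_images warp_neq_weft[symmetric])
  next
    case False
    then have "P (cell i j) = weft j" using not_warp_up_iff[OF P] by blast
    then show ?thesis using False by (simp add: quarter_turn_images)
  qed
  then show ?thesis
    using carries_cell[OF g, of i j] lowermost_eq_warp_iff[OF P, of "a - j - 1" "i + b"]
    by (cases \<epsilon>) (auto simp: quarter_turn_images warp_up_def split: if_splits)
qed

text \<open>The translations by \<open>w\<close> and \<open>\<i> * w\<close> are conjugate under the quarter-turn, so they have the same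
  effect on the sides; that effect cancels in the translation by their sum \<open>(1 + \<i>) * w\<close>.\<close>

lemma one_plus_i_translation_preserves:
  assumes P: "prefabric P"
    and t: "(\<lambda>z. \<i> * z + Complex (of_int p) (of_int q)) \<in> planar_group P"
    and w: "(\<lambda>z. z + Complex (of_int a) (of_int b)) \<in> planar_group P"
  shows "warp_up P (i + (a - b)) (j + (a + b)) \<longleftrightarrow> warp_up P i j"
proof -
  obtain \<epsilon> where \<epsilon>: "(\<lambda>z. z + Complex (of_int a) (of_int b), \<epsilon>) \<in> symmetry_group P"
    using w unfolding planar_group_def by force
  obtain \<delta> where \<delta>: "(\<lambda>z. \<i> * z + Complex (of_int p) (of_int q), \<delta>) \<in> symmetry_group P"
    using t unfolding planar_group_def by force
  note tr = warp_up_translation[OF P \<epsilon>] and qt = warp_up_quarter_turn[OF P \<delta>]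
  \<comment> \<open>Pull the cell back along the quarter-turn, translate by \<open>w\<close>, and push it forward: the effect
     \<open>\<delta>\<close> is met twice and drops out.\<close>
  have rotated: "warp_up P (i - b) (j + a) \<longleftrightarrow> (warp_up P i j \<longleftrightarrow> \<epsilon> = Preserve)" for i j
    using qt[of "p - i - 1" "j - q"] qt[of "p - i - 1 + b" "j - q + a"]
      tr[of "j - q" "p - i - 1"]
    by (cases \<delta>; cases \<epsilon>) (simp_all add: algebra_simps)
  show ?thesis
    using rotated[of "i + a" "j + b"] tr[of i j] by (cases \<epsilon>) (simp_all add: algebra_simps)
qed

text \<open>The vectors \<open>2 - 2 * \<i>\<close> and \<open>2 + 2 * \<i>\<close> become \<open>4\<close> and \<open>4 * \<i>\<close> on multiplication by \<open>1 + \<i>\<close>.\<close>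

lemma repeats_every_4:
  assumes P: "prefabric P" and p4: "type_p4 (planar_group P)"
    and t: "(\<lambda>z. \<i> * z + Complex (of_int p) (of_int q)) \<in> planar_group P"
    and w: "2 - 2 * \<i> \<in> translation_vectors (planar_group P)"
  shows "repeats_every P 4"
proof -
  have "2 - 2 * \<i> = Complex (of_int 2) (of_int (-2))"
    "\<i> * (2 - 2 * \<i>) = Complex (of_int 2) (of_int 2)" by (simp_all add: complex_eq_iff)
  then have "(\<lambda>z. z + Complex (of_int 2) (of_int (-2))) \<in> planar_group P"
    and "(\<lambda>z. z + Complex (of_int 2) (of_int 2)) \<in> planar_group P"
    using w translation_vectors_i[OF p4 w] unfolding translation_vectors_def by auto
  from one_plus_i_translation_preserves[OF P t this(1)]
    one_plus_i_translation_preserves[OF P t this(2)]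
  have "warp_up P (i + 4) j = warp_up P i j" "warp_up P i (j + 4) = warp_up P i j" for i j
    by simp_all
  then show ?thesis
    unfolding repeats_every_def warp_up_def
    using prefabric_cases[OF P] warp_neq_weft by (metis of_nat_numeral)
qed


section \<open>Levels\<close>

text \<open>A square described by its centre, which escribing does not change, instead of a corner.\<close>

definition square_about :: "complex \<Rightarrow> complex \<Rightarrow> square" where
  "square_about m s = Square (m - s * (1 + \<i>) / 2) s"

text \<open>The half-diagonals \<open>\<plusminus> s * (1 \<plusminus> \<i>) / 2\<close> of the inner square are the perpendiculars from the centre to
  the sides of the outer one.\<close>

lemma square_about_escribes: "escribes (square_about m ((1 + \<i>) * s)) (square_about m s)"
proof -
  have "corners (square_about m s) =
      {m - s * (1 + \<i>) / 2, m + s * (1 - \<i>) / 2, m + s * (1 + \<i>) / 2, m - s * (1 - \<i>) / 2}"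
    unfolding square_about_def corners.simps
    by (intro arg_cong2[where f = insert] refl) (auto simp: complex_eq_iff field_simps)
  moreover have "side_midpoints (square_about m ((1 + \<i>) * s)) =
      {m + s * (1 - \<i>) / 2, m + s * (1 + \<i>) / 2, m - s * (1 - \<i>) / 2, m - s * (1 + \<i>) / 2}"
    unfolding square_about_def side_midpoints.simps
    by (intro arg_cong2[where f = insert] refl)
      (auto simp: complex_eq_iff midpoint_def field_simps)
  ultimately show ?thesis unfolding escribes_def by blast
qed

lemma has_level_power:
  assumes "has_level 1 (square_about m s)"
  shows "has_level (Suc k) (square_about m ((1 + \<i>) ^ k * s))"
proof (induction k)
  case 0
  then show ?case using assms by simp
next
  case (Suc k)
  from has_level.step[OF Suc square_about_escribes] show ?case by (simp add: mult.assoc)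
qed

text \<open>As \<open>s\<close> is not divisible by \<open>1 + \<i>\<close>, the half-diagonal \<open>s * (1 + \<i>) / 2\<close> is a cell centre. Hence the
  corners are cell centres if the square is centred at a cell corner, and conversely.\<close>

lemma has_level_one:
  fixes a b :: int
  assumes s: "s = Complex (of_int a) (of_int b)" "coprime a b" "odd (a + b)" "a \<noteq> 0" "b \<noteq> 0"
    and m: "m \<in> cell_corners \<union> cell_centres"
  shows "has_level 1 (square_about m s)"
proof (rule has_level.one)
  have "\<bar>a\<bar> \<noteq> \<bar>b\<bar>" using s(3) by (auto simp: abs_eq_iff)
  then have "\<bar>of_int a\<bar> \<noteq> (\<bar>of_int b\<bar> :: real)" by (metis of_int_abs of_int_eq_iff)
  then show "oblique (square_about m s)"
    using s by (simp add: oblique_def square_about_def)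
  have "coprime (nat \<bar>a\<bar>) (nat \<bar>b\<bar>)" using s(2) by (simp add: coprime_int_iff[symmetric])
  then show "level_one_size (square_about m s)"
    unfolding level_one_size_def
    using s by (intro exI[of _ "nat \<bar>a\<bar>"] exI[of _ "nat \<bar>b\<bar>"])
      (auto simp: square_about_def even_nat_iff)
  let ?p = "m - s * (1 + \<i>) / 2"
  have "s * (1 + \<i>) / 2 \<in> cell_centres" using half_one_plus_i_multiple(2)[OF s(1,3)] .
  then obtain x y where xy: "s * (1 + \<i>) / 2 = Complex (of_int x + 1/2) (of_int y + 1/2)"
    unfolding cell_centres_def by blast
  have s_int: "s \<in> cell_corners" using s(1) by (auto simp: cell_corners_def)
  have c: "corners (square_about m s) = (\<lambda>q. ?p + q * s) ` {0, 1, 1 + \<i>, \<i>}"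
    by (simp add: square_about_def algebra_simps)
  have shift: "z + w \<in> A" if zw: "z \<in> A" "w \<in> cell_corners" "A = cell_corners \<or> A = cell_centres"
    for z w A
  proof -
    obtain k l where w: "w = Complex (of_int k) (of_int l)"
      using zw(2) unfolding cell_corners_def by blast
    have "\<exists>k' l'. z + w = Complex (of_int k' + e) (of_int l' + e)"
      if "z = Complex (of_int i + e) (of_int j + e)" for i j e
      by (rule exI[of _ "i + k"], rule exI[of _ "j + l"]) (simp add: that w complex_eq_iff)
    from this[of _ 0] this[of _ "1/2"] zw(1,3) show ?thesis
      unfolding cell_corners_def cell_centres_def by auto
  qed
  have "?p \<in> cell_corners \<or> ?p \<in> cell_centres"
    using m
  proof
    assume "m \<in> cell_corners"
    then obtain k l where "m = Complex (of_int k) (of_int l)" unfolding cell_corners_def by blast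
    then have "?p = Complex (of_int (k - x - 1) + 1/2) (of_int (l - y - 1) + 1/2)"
      by (simp add: xy complex_eq_iff)
    then show ?thesis unfolding cell_centres_def by blast
  next
    assume "m \<in> cell_centres"
    then obtain k l where "m = Complex (of_int k + 1/2) (of_int l + 1/2)"
      unfolding cell_centres_def by blast
    then have "?p = Complex (of_int (k - x)) (of_int (l - y))"
      by (simp add: xy complex_eq_iff)
    then show ?thesis unfolding cell_corners_def by blast
  qed
  moreover have "q * s \<in> cell_corners" if "q \<in> {0, 1, 1 + \<i>, \<i>}" for q
    using that s_int by (intro cell_corners_mult) (auto simp: cell_corners_iff)
  ultimately show "corners (square_about m s) \<subseteq> cell_corners \<or>
      corners (square_about m s) \<subseteq> cell_centres"
    unfolding c using shift by (metis (no_types, lifting) image_subsetI)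
qed


section \<open>The lattice unit\<close>

text \<open>The hypothesis \<open>s' * cnj s' = 1\<close> says that \<open>s'\<close> is a unit, with inverse \<open>cnj s'\<close>. The claim holds
  because \<open>2 - 2 * \<i> = - (1 + \<i>)\<^sup>3\<close>.\<close>

lemma unit_multiple_divides_two_minus_two_i:
  assumes "s' \<in> cell_corners" "s' * cnj s' = 1" "k \<le> 3"
  shows "\<exists>q\<in>cell_corners. 2 - 2 * \<i> = q * ((1 + \<i>) ^ k * s')"
proof
  have cube: "2 - 2 * \<i> = - ((1 + \<i>) ^ 3)"
    by (simp add: power3_eq_cube complex_eq_iff)
  have "(1 + \<i>) ^ 3 = (1 + \<i>) ^ (3 - k) * (1 + \<i>) ^ k"
    using assms(3) by (simp add: power_add[symmetric])
  then have "2 - 2 * \<i> = - 1 * ((1 + \<i>) ^ (3 - k) * (1 + \<i>) ^ k) * (s' * cnj s')"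
    using cube assms(2) by simp
  then show "2 - 2 * \<i> = (- 1 * ((1 + \<i>) ^ (3 - k) * cnj s')) * ((1 + \<i>) ^ k * s')"
    by (simp only: mult_ac)
  show "- 1 * ((1 + \<i>) ^ (3 - k) * cnj s') \<in> cell_corners"
    by (intro cell_corners_mult cell_corners_one_plus_i_power cell_corners_cnj assms)
      (simp add: cell_corners_iff)
qed

theorem theorem7:
  fixes P :: "complex set \<Rightarrow> complex set" and n :: nat
  assumes "prefabric P"
    and "isonemal P"
    and "has_order P n" and "n > 4"
    and "symmetry_type_p4_none P \<or> symmetry_type_p4_p4 P \<or> symmetry_type_p4_p2 P"
  shows "\<exists>Q. lattice_unit (planar_group P) Q \<and>
           (centre Q \<in> cell_centres \<and> (\<exists>l\<in>{1, 2}. has_level l Q) \<or>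
            centre Q \<in> cell_corners \<and> (\<exists>l\<in>{1, 2, 3, 4}. has_level l Q))"
proof -
  let ?L = "translation_vectors (planar_group P)"
  have p4: "type_p4 (planar_group P)"
    using assms(5) unfolding symmetry_type_p4_none_def symmetry_type_p4_p4_def
      symmetry_type_p4_p2_def by blast
  obtain t where t: "(\<lambda>z. \<i> * z + t) \<in> planar_group P"
    using p4_quarter_turn_exists[OF p4] .
  then obtain p q where tpq: "t = Complex (of_int p) (of_int q)"
    using planar_quarter_turn_integral unfolding cell_corners_def by blast
  obtain s where s: "s \<in> ?L" "?L = lattice_generated s (\<i> * s)"
    using planar_p4_lattice_principal[OF p4] .
  then obtain a b where sab: "s = Complex (of_int a) (of_int b)"
    using planar_translation_integral unfolding translation_vectors_def cell_corners_def by blast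
  have gcd: "gcd a b = 1 \<or> gcd a b = 2 \<and> even (p + q)"
    using isonemal_gcd[OF assms(2) p4] t s(2) unfolding tpq sab by blast
  then have "gcd a b = 1 \<or> gcd a b = 2" by blast
  from gaussian_factorization[OF this] obtain a' b' k
    where k: "k \<le> (3::nat)" and ab': "coprime a' b'" "odd (a' + b')"
    and fac: "Complex (of_int a) (of_int b) = (1 + \<i>) ^ k * Complex (of_int a') (of_int b')"
    and k2: "k \<ge> 2 \<Longrightarrow> gcd a b = 2"
    by metis
  define s' where "s' = Complex (of_int a') (of_int b')"
  have s_fac: "s = (1 + \<i>) ^ k * s'" using fac by (simp add: s'_def sab)
  have not4: "\<not> repeats_every P 4" using assms(3,4) unfolding has_order_def by auto
  \<comment> \<open>A side of level 1 parallel to the strands would be a unit, making the order at most 4.\<close>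
  have "a' \<noteq> 0 \<and> b' \<noteq> 0"
  proof (rule ccontr)
    assume "\<not> (a' \<noteq> 0 \<and> b' \<noteq> 0)"
    then have "a' = 0 \<and> \<bar>b'\<bar> = 1 \<or> b' = 0 \<and> \<bar>a'\<bar> = 1" using ab'(1) by auto
    then have unit: "s' * cnj s' = 1" by (auto simp: s'_def complex_eq_iff abs_if split: if_splits)
    have "s' \<in> cell_corners" by (auto simp: s'_def cell_corners_def)
    from unit_multiple_divides_two_minus_two_i[OF this unit k]
    obtain x where "x \<in> cell_corners" "2 - 2 * \<i> = x * s" unfolding s_fac by blast
    then have "2 - 2 * \<i> \<in> ?L" using translation_vectors_mult[OF p4 _ s(1)] by metis
    then show False using repeats_every_4[OF assms(1) p4] t not4 unfolding tpq by blast
  qed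
  then have nonzero: "a' \<noteq> 0" "b' \<noteq> 0" by auto
  \<comment> \<open>The centre of the square that has its base corner at the centre \<open>t * (1 + \<i>) / 2\<close> of the
     quarter-turn and side vector \<open>s\<close>.\<close>
  define m where "m = (t + s) * (1 + \<i>) / 2"
  have ts: "t + s = Complex (of_int (p + a)) (of_int (q + b))"
    by (simp add: tpq sab complex_eq_iff)
  have m: "m \<in> cell_corners \<union> cell_centres"
    unfolding m_def using half_one_plus_i_multiple[OF ts] by blast
  have m2: "m \<in> cell_corners" if "k \<ge> 2"
  proof -
    have "even a" "even b" using k2[OF that] by (metis gcd_dvd1, metis gcd_dvd2)
    moreover have "even (p + q)" using gcd k2[OF that] by auto
    ultimately have "even (p + a + (q + b))" by simp
    then show ?thesis unfolding m_def by (rule half_one_plus_i_multiple(1)[OF ts])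
  qed
  define Q where "Q = Square (t * (1 + \<i>) / 2) s"
  have "Q = square_about m ((1 + \<i>) ^ k * s')"
    unfolding s_fac[symmetric] by (simp add: Q_def square_about_def m_def field_simps)
  then have level: "has_level (Suc k) Q"
    using has_level_power[OF has_level_one[OF s'_def ab' nonzero m]] by simp
  have centre: "centre Q = m"
    by (simp add: Q_def m_def midpoint_def complex_eq_iff field_simps)
  have "lattice_unit (planar_group P) Q"
    unfolding Q_def by (rule lattice_unit_at_quarter_turn[OF p4 t s])
  moreover have "m \<in> cell_centres \<and> (\<exists>l\<in>{1, 2}. has_level l Q) \<or>
      m \<in> cell_corners \<and> (\<exists>l\<in>{1, 2, 3, 4}. has_level l Q)"
  proof (cases "k \<ge> 2")
    case True
    then have "Suc k \<in> {1, 2, 3, 4}" using k by auto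
    then show ?thesis using m2[OF True] level by blast
  next
    case False
    then have "Suc k \<in> {1, 2}" by auto
    then show ?thesis using m level by blast
  qed
  ultimately show ?thesis using centre by auto
qed

end
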